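(* Let $\succ_0$ and $\succ$ be preference relations over the same relation schema such that $\succ_0$ is a weak order (WO) and $\succ$ is a strict partial order (SPO). Then the preference relation $\succ_0\triangleright\succ$ is an SPO.
   Context: A relation schema $R(A_1,\dots,A_k)$ assigns each attribute $A_i$ a domain $U_i$, either a countably infinite set $D$ of uninterpreted constants or the set $\mathbb{Q}$ of rational numbers; tuples are elements of $U=U_1\times\cdots\times U_k$. A preference relation over $R$ is any subset of $U\times U$ (possibly infinite). A preference relation $\succ$ is an SPO if it is irreflexive and transitive; it is a WO if it is an SPO and negatively transitive: for all $x,y,z$, $(x\not\succ y\wedge y\not\succ z)$ implies $x\not\succ z$. Prioritized composition: $t_1(\succ_0\triangleright\succ)t_2$ iff $t_1\succ_0 t_2\vee(t_2\not\succ_0 t_1\wedge t_1\succ t_2)$. *)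

theory Defs
  imports Main "HOL.Rat" "HOL-Library.Countable_Set"
begin

text \<open>
  A relation schema \<open>R(A\<^sub>1, \<dots>, A\<^sub>k)\<close> is the list of its attributes, each paired with the kind of
  its domain: the set \<open>D\<close> of uninterpreted constants, which is a parameter throughout, or the
  rational numbers.
\<close>

datatype domain_kind = Constants | Rationals

datatype 'd val = Const 'd | Number rat

type_synonym 'a schema = "('a \<times> domain_kind) list"

type_synonym 'd tuple = "'d val list"

definition relation_schema :: "'a schema \<Rightarrow> bool" where
  "relation_schema R \<longleftrightarrow> distinct (map fst R)"

fun attr_domain :: "'d set \<Rightarrow> domain_kind \<Rightarrow> 'd val set" where
  "attr_domain D Constants = Const ` D"
| "attr_domain D Rationals = range Number"

definition tuples :: "'d set \<Rightarrow> 'a schema \<Rightarrow> 'd tuple set" where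
  "tuples D R = listset (map (\<lambda>(A, \<kappa>). attr_domain D \<kappa>) R)"

definition preference_relation :: "'d set \<Rightarrow> 'a schema \<Rightarrow> 'd tuple rel \<Rightarrow> bool" where
  "preference_relation D R P \<longleftrightarrow> P \<subseteq> tuples D R \<times> tuples D R"

definition negatively_trans_on :: "'b set \<Rightarrow> 'b rel \<Rightarrow> bool" where
  "negatively_trans_on S P \<longleftrightarrow>
    (\<forall>x\<in>S. \<forall>y\<in>S. \<forall>z\<in>S. (x, y) \<notin> P \<and> (y, z) \<notin> P \<longrightarrow> (x, z) \<notin> P)"

definition SPO_on :: "'b set \<Rightarrow> 'b rel \<Rightarrow> bool" where
  "SPO_on S P \<longleftrightarrow> irrefl_on S P \<and> trans_on S P"

definition WO_on :: "'b set \<Rightarrow> 'b rel \<Rightarrow> bool" where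
  "WO_on S P \<longleftrightarrow> SPO_on S P \<and> negatively_trans_on S P"

text \<open>No restriction to tuples of the schema is needed here: the composition of two relations
  contained in \<open>S \<times> S\<close> is contained in \<open>S \<times> S\<close>.\<close>

definition prioritized :: "'b rel \<Rightarrow> 'b rel \<Rightarrow> 'b rel" (infixr "\<triangleright>" 65) where
  "P\<^sub>0 \<triangleright> P = {(t\<^sub>1, t\<^sub>2). (t\<^sub>1, t\<^sub>2) \<in> P\<^sub>0 \<or> ((t\<^sub>2, t\<^sub>1) \<notin> P\<^sub>0 \<and> (t\<^sub>1, t\<^sub>2) \<in> P)}"

end

theory Submission
  imports Defs
begin

text \<open>
  In contrapositive form, negative transitivity says that \<open>(x, z) \<in> P\<^sub>0\<close> forces
  \<open>(x, y) \<in> P\<^sub>0\<close> or \<open>(y, z) \<in> P\<^sub>0\<close> for every \<open>y\<close>. Hence \<open>P\<^sub>0\<close>-indifference is compatible with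
  \<open>P\<^sub>0\<close>, and is itself transitive, so \<open>P\<close> can be used to break ties without creating cycles.
\<close>

lemma SPO_on_prioritized:
  assumes "WO_on S P\<^sub>0" and "SPO_on S P"
  shows "SPO_on S (P\<^sub>0 \<triangleright> P)"
proof -
  have split: "(x, y) \<in> P\<^sub>0 \<or> (y, z) \<in> P\<^sub>0"
    if "(x, z) \<in> P\<^sub>0" "x \<in> S" "y \<in> S" "z \<in> S" for x y z
    using assms(1) that unfolding WO_on_def negatively_trans_on_def by blast
  have trans: "trans_on S P\<^sub>0" "trans_on S P" and irrefl: "irrefl_on S P\<^sub>0" "irrefl_on S P"
    using assms by (simp_all add: WO_on_def SPO_on_def)
  have "irrefl_on S (P\<^sub>0 \<triangleright> P)"
    using irrefl by (auto simp: irrefl_on_def prioritized_def)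
  moreover have "trans_on S (P\<^sub>0 \<triangleright> P)"
  proof (rule trans_onI)
    fix x y z
    assume S: "x \<in> S" "y \<in> S" "z \<in> S"
      and xy: "(x, y) \<in> P\<^sub>0 \<triangleright> P" and yz: "(y, z) \<in> P\<^sub>0 \<triangleright> P"
    show "(x, z) \<in> P\<^sub>0 \<triangleright> P"
    proof (cases "(x, y) \<in> P\<^sub>0 \<or> (y, z) \<in> P\<^sub>0")
      case True
      \<comment> \<open>If only one step lies in \<open>P\<^sub>0\<close>, the other is not reversed
        by \<open>P\<^sub>0\<close>. Splitting the former at the third point (the last argument of
        \<open>split\<close>) then leaves only \<open>(x, z)\<close>. If both do, transitivity
        applies.\<close>
      then have "(x, z) \<in> P\<^sub>0"
        using xy yz S split[of x y z] split[of y z x] trans_onD[OF trans(1), of x y z]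
        by (auto simp: prioritized_def)
      then show ?thesis by (simp add: prioritized_def)
    next
      case False
      \<comment> \<open>Both steps come from \<open>P\<close> and neither is reversed by
        \<open>P\<^sub>0\<close>; a pair \<open>(z, x)\<close> in \<open>P\<^sub>0\<close> would
        split at \<open>y\<close> into one of these reversals.\<close>
      then have "(x, z) \<in> P" and "(z, x) \<notin> P\<^sub>0"
        using xy yz S split[of z x y] trans_onD[OF trans(2), of x y z]
        by (auto simp: prioritized_def)
      then show ?thesis by (simp add: prioritized_def)
    qed
  qed
  ultimately show ?thesis by (simp add: SPO_on_def)
qed

theorem theorem3:
  fixes D :: "'d set" and R :: "'a schema" and P\<^sub>0 P :: "'d tuple rel"
  assumes "countable D" and "infinite D"
    and "relation_schema R"
    and "preference_relation D R P\<^sub>0" and "preference_relation D R P"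
    and "WO_on (tuples D R) P\<^sub>0"
    and "SPO_on (tuples D R) P"
  shows "preference_relation D R (P\<^sub>0 \<triangleright> P) \<and> SPO_on (tuples D R) (P\<^sub>0 \<triangleright> P)"
proof
  show "preference_relation D R (P\<^sub>0 \<triangleright> P)"
    using assms(4,5) by (auto simp: preference_relation_def prioritized_def)
  show "SPO_on (tuples D R) (P\<^sub>0 \<triangleright> P)"
    using assms(6,7) by (rule SPO_on_prioritized)
qed

end
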